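(* Let $1<p<\infty$ and $p'=\frac{p}{p-1}$. Then, for all non-zero complex-valued $f\in C_{0}^{\infty}(\mathbb{R}^{n})$, $$\left(\int_{\mathbb{R}^{n}}|\nabla f|^{p}\,dz\right)\left(\int_{\mathbb{R}^{n}}|z|^{p'}|f|^{p}\,dz\right)^{p-1}-\left(\frac{n}{p}\right)^{p}\left(\int_{\mathbb{R}^{n}}|f|^{p}\,dz\right)^{p}=\left(\int_{\mathbb{R}^{n}}|z|^{p'}|f|^{p}\,dz\right)^{p-1}\int_{\mathbb{R}^{n}}C_{p}\left(\nabla f,e^{-\alpha_{p,n}|z|^{p'}}\nabla\left(\frac{f}{e^{-\alpha_{p,n}|z|^{p'}}}\right)\right)dz,$$ where $$\alpha_{p,n}=\frac{n}{p}\,\frac{p-1}{p}\,\frac{\int_{\mathbb{R}^{n}}|f|^{p}\,dz}{\int_{\mathbb{R}^{n}}|z|^{p'}|f|^{p}\,dz}.$$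
   Context: $\nabla$ is the standard Euclidean gradient on $\mathbb{R}^n$, $|\cdot|$ the Euclidean norm, $dz$ Lebesgue measure, and $C_0^\infty(\mathbb{R}^n)$ the space of smooth compactly supported functions. For $1<p<\infty$ and $\xi,\eta\in\mathbb{C}^{n}$, $$C_p(\xi,\eta):=|\xi|^p-|\xi-\eta|^p-p|\xi-\eta|^{p-2}\,\mathrm{Re}\big((\xi-\eta)\cdot\overline{\eta}\big)\ \ (\geq0),$$ the last term being read as $0$ when $\xi=\eta$. *)

theory Defs
  imports "HOL-Analysis.Analysis"
begin

definition partial :: "'n \<Rightarrow> (real^'n \<Rightarrow> complex) \<Rightarrow> real^'n \<Rightarrow> complex" where
  "partial i f z = vector_derivative (\<lambda>t. f (z + t *\<^sub>R axis i 1)) (at 0)"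

definition grad :: "(real^'n \<Rightarrow> complex) \<Rightarrow> real^'n \<Rightarrow> complex^'n" where
  "grad f z = (\<chi> i. partial i f z)"

primrec C_k :: "nat \<Rightarrow> (real^'n \<Rightarrow> complex) \<Rightarrow> bool" where
  "C_k 0 f \<longleftrightarrow> continuous_on UNIV f"
| "C_k (Suc k) f \<longleftrightarrow> f differentiable_on UNIV \<and> (\<forall>i. C_k k (partial i f))"

definition test_functions :: "(real^'n \<Rightarrow> complex) set" where
  "test_functions = {f. (\<forall>k. C_k k f) \<and> compact (closure {z. f z \<noteq> 0})}"

text \<open>
  The norm on \<^typ>\<open>complex^'n\<close> is the Hermitian norm. For \<open>\<xi> = \<eta>\<close> the last term
  vanishes, as the sum does (for \<open>p < 2\<close> also \<open>0 powr (p - 2) = 0\<close>).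
\<close>

definition C_p :: "real \<Rightarrow> complex^'n \<Rightarrow> complex^'n \<Rightarrow> real" where
  "C_p p \<xi> \<eta> = norm \<xi> powr p - norm (\<xi> - \<eta>) powr p
     - p * norm (\<xi> - \<eta>) powr (p - 2) * Re (\<Sum>i\<in>UNIV. (\<xi> - \<eta>) $ i * cnj (\<eta> $ i))"

end

theory Submission
  imports Defs
begin

text \<open>
  Write \<open>\<phi>(z) = |z|\<^sup>q\<close> for the conjugate exponent \<open>q = p / (p - 1)\<close> and \<open>\<eta>\<close> for the
  second argument of \<open>C\<^sub>p\<close>. The product rule gives \<open>\<eta> = \<nabla>f + \<alpha> f \<nabla>\<phi>\<close>, so
  \<open>\<nabla>f - \<eta>\<close> is the vector \<open>- c |z| powr (q - 2) f(z) z\<close> with \<open>c = \<alpha> q\<close>. The conjugate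
  exponent is exactly the one for which all powers of \<open>|z|\<close> cancel in the mixed
  term of \<open>C\<^sub>p\<close>, and there remains (\<open>C_p_shift_radial\<close>)
  \<open>C\<^sub>p(\<nabla>f, \<eta>) = |\<nabla>f| powr p + (p - 1) (c powr p) \<phi> |f| powr p + c powr (p - 1) (z \<cdot> \<nabla>(|f| powr p))\<close>.

  For a compactly supported function \<open>g\<close> on the \<open>n\<close>-dimensional space, the integral of
  \<open>z \<cdot> \<nabla>g\<close> is \<open>- n\<close> times the integral of \<open>g\<close> (\<open>integral_euler_derivative\<close>). With \<open>A\<close>,
  \<open>B\<close>, \<open>M\<close> the integrals of \<open>|\<nabla>f| powr p\<close>, \<open>\<phi> |f| powr p\<close> and \<open>|f| powr p\<close>, the integral of
  \<open>C\<^sub>p\<close> is therefore \<open>A + (p - 1) (c powr p) B - n (c powr (p - 1)) M\<close>. The choice of \<open>\<alpha>\<close> means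
  \<open>p c B = n M\<close>, which turns the last two terms into \<open>- (c powr p) B\<close>; multiplied by
  \<open>B powr (p - 1)\<close> this is \<open>- (c B) powr p = - ((n / p) M) powr p\<close>.
\<close>

section \<open>Derivatives\<close>

text \<open>
  At the origin \<open>|h| powr p\<close> is of smaller order than \<open>|h|\<close>, so the derivative is zero, as is
  the stated formula. Having one formula at
  every point covers the zeros of \<open>f\<close> in \<open>|f| powr p\<close> and the origin in the weight alike.
\<close>

lemma has_derivative_norm_powr:
  fixes x :: "'a::real_inner"
  assumes "1 < p"
  shows "((\<lambda>x. norm x powr p) has_derivative (\<lambda>h. p * norm x powr (p - 2) * (x \<bullet> h))) (at x)"
proof (cases "x = 0")
  case True
  have "((\<lambda>h::'a. norm h powr (p - 1)) \<longlongrightarrow> 0 powr (p - 1)) (at 0)"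
    by (rule tendsto_powr2) (use assms in \<open>auto intro!: tendsto_eq_intros\<close>)
  then have "((\<lambda>h::'a. norm h powr (p - 1)) \<longlongrightarrow> 0) (at 0)" by simp
  moreover have "\<forall>\<^sub>F h in at (0::'a). norm h powr (p - 1) = norm (norm h powr p) / norm h"
    by (rule eventually_at_topological[THEN iffD2], rule exI[of _ UNIV]) (auto simp: powr_diff)
  ultimately have "((\<lambda>h::'a. norm (norm h powr p) / norm h) \<longlongrightarrow> 0) (at 0)"
    by (rule Lim_transform_eventually)
  then show ?thesis
    using True by (simp add: has_derivative_iff_norm)
next
  case False
  have "((\<lambda>x. norm x powr p) has_derivative (\<lambda>h. p * norm x powr (p - 1) * (sgn x \<bullet> h))) (at x)"
    using has_derivative_powr[OF has_derivative_norm[OF False] has_derivative_const[of p]] False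
    by (simp add: powr_diff inner_commute field_simps)
  moreover have "norm x powr (p - 1) * (sgn x \<bullet> h) = norm x powr (p - 2) * (x \<bullet> h)" for h
  proof -
    have "norm x powr (p - 1) = norm x powr (p - 2) * norm x"
      using False powr_add[of "norm x" "p - 2" 1] by simp
    then show ?thesis using False by (simp add: sgn_div_norm)
  qed
  ultimately show ?thesis by (simp add: mult.assoc)
qed

lemma continuous_on_norm_powr:
  fixes g :: "'a::topological_space \<Rightarrow> 'b::real_normed_vector"
  assumes "0 < q" and "continuous_on S g"
  shows "continuous_on S (\<lambda>x. norm (g x) powr q)"
  by (rule continuous_on_powr') (use assms in \<open>auto intro: continuous_on_norm\<close>)

lemma partial_eq_derivative:
  assumes "(f has_derivative f') (at z)"
  shows "partial i f z = f' (axis i 1)"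
proof -
  have "((\<lambda>t. z + t *\<^sub>R axis i 1) has_derivative (\<lambda>t. t *\<^sub>R axis i 1)) (at (0::real))"
    by (auto intro!: derivative_eq_intros)
  from has_derivative_compose[OF this, of f f'] assms
  have "((\<lambda>t. f (z + t *\<^sub>R axis i 1)) has_derivative (\<lambda>t. f' (t *\<^sub>R axis i 1))) (at 0)"
    by simp
  moreover have "f' (t *\<^sub>R axis i 1) = t *\<^sub>R f' (axis i 1)" for t
    using assms by (simp add: has_derivative_def linear_cmul bounded_linear.linear)
  ultimately show ?thesis
    unfolding partial_def by (intro vector_derivative_at) (simp add: has_vector_derivative_def)
qed

lemma derivative_eq_sum_partial:
  fixes f :: "real^'n \<Rightarrow> complex"
  assumes "(f has_derivative f') (at z)"
  shows "f' v = (\<Sum>i\<in>UNIV. of_real (v $ i) * partial i f z)"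
proof -
  have "f' v = f' (\<Sum>i\<in>UNIV. (v $ i) *\<^sub>R axis i 1)"
    using basis_expansion[of v] by (simp add: scalar_mult_eq_scaleR)
  also have "\<dots> = (\<Sum>i\<in>UNIV. (v $ i) *\<^sub>R f' (axis i 1))"
    using assms by (simp add: has_derivative_def bounded_linear.linear linear_sum linear_cmul)
  finally show ?thesis
    by (simp add: partial_eq_derivative[OF assms] scaleR_conv_of_real)
qed

text \<open>
  Dividing by the Gaussian-like weight is multiplying by its reciprocal, and the
  outer factor undoes this multiplication after the product rule.
\<close>

lemma grad_radial_quotient:
  fixes f :: "real^'n \<Rightarrow> complex"
  assumes "1 < q" and "(f has_derivative f') (at z)"
  shows "exp (- \<alpha> * norm z powr q) *\<^sub>R
      grad (\<lambda>w. f w / complex_of_real (exp (- \<alpha> * norm w powr q))) z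
    = (\<chi> i. grad f z $ i + of_real (\<alpha> * q * norm z powr (q - 2) * z $ i) * f z)"
proof -
  define e where "e w = exp (\<alpha> * norm w powr q)" for w :: "real^'n"
  have quot: "(\<lambda>w. f w / complex_of_real (exp (- \<alpha> * norm w powr q))) = (\<lambda>w. e w *\<^sub>R f w)"
    by (simp add: e_def exp_minus scaleR_conv_of_real field_simps)
  have "(e has_derivative (\<lambda>h. e z * (\<alpha> * (q * norm z powr (q - 2) * (z \<bullet> h))))) (at z)"
    unfolding e_def
    by (rule derivative_eq_intros has_derivative_norm_powr[OF assms(1)] refl)+ (simp add: fun_eq_iff)
  from has_derivative_scaleR[OF this assms(2)]
  have "partial i (\<lambda>w. e w *\<^sub>R f w) z
      = e z *\<^sub>R f' (axis i 1) + (e z * (\<alpha> * (q * norm z powr (q - 2) * (z \<bullet> axis i 1)))) *\<^sub>R f z" for i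
    by (rule partial_eq_derivative)
  then have "exp (- \<alpha> * norm z powr q) *\<^sub>R partial i (\<lambda>w. e w *\<^sub>R f w) z
      = (exp (- \<alpha> * norm z powr q) * e z) *\<^sub>R
          (f' (axis i 1) + (\<alpha> * (q * norm z powr (q - 2) * z $ i)) *\<^sub>R f z)" for i
    by (simp add: inner_axis scaleR_right_distrib mult.assoc)
  moreover have "exp (- \<alpha> * norm z powr q) * e z = 1"
    by (simp add: e_def exp_minus)
  ultimately show ?thesis
    unfolding quot
    by (simp add: vec_eq_iff grad_def partial_eq_derivative[OF assms(2)]
        scaleR_conv_of_real[of _ "f z"] mult.assoc)
qed

section \<open>The remainder for a radial shift\<close>

lemma norm_complex_multiple:
  fixes x :: "real^'n"
  shows "norm (\<chi> i. (a::complex) * of_real (x $ i)) = norm a * norm x"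
  by (simp add: norm_vec_def norm_mult L2_set_right_distrib)

text \<open>
  The difference \<open>v\<close> of the two arguments has norm \<open>c |x| powr (p' - 1) |w|\<close>. Since
  \<open>(p' - 1) p = p'\<close>, its \<open>p\<close>-th power carries the weight \<open>|x| powr p'\<close>; it occurs once
  with factor \<open>- 1\<close> and once, from the quadratic part of the inner product, with factor \<open>p\<close>.
  In the part linear in \<open>\<xi>\<close> the exponents of \<open>|x|\<close> add up to \<open>(p' - 1) (p - 2) + (p' - 2) = 0\<close>.
\<close>

lemma C_p_shift_radial:
  fixes x :: "real^'n" and \<xi> :: "complex^'n" and w :: complex
  assumes p: "1 < p" and p': "p' = p / (p - 1)" and c: "0 \<le> c"
  shows "C_p p \<xi> (\<chi> i. \<xi> $ i + of_real (c * norm x powr (p' - 2) * x $ i) * w)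
    = norm \<xi> powr p + (p - 1) * c powr p * (norm x powr p' * norm w powr p)
      + c powr (p - 1) * (p * norm w powr (p - 2) * (w \<bullet> (\<Sum>i\<in>UNIV. of_real (x $ i) * \<xi> $ i)))"
proof -
  define a where "a = - (of_real (c * norm x powr (p' - 2)) * w)"
  define v :: "complex^'n" where "v = (\<chi> i. a * of_real (x $ i))"
  define \<eta> where "\<eta> = \<xi> - v"
  define I where "I = w \<bullet> (\<Sum>i\<in>UNIV. of_real (x $ i) * \<xi> $ i)"
  have \<eta>_eq: "(\<chi> i. \<xi> $ i + of_real (c * norm x powr (p' - 2) * x $ i) * w) = \<eta>"
    by (simp add: \<eta>_def v_def a_def vec_eq_iff)
  have norm_v: "norm v = c * norm x powr (p' - 2) * norm x * norm w"
    using c unfolding v_def norm_complex_multiple by (simp add: a_def norm_mult)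
  have sq: "Re (\<Sum>i\<in>UNIV. v $ i * cnj (v $ i)) = (norm v)\<^sup>2"
    by (simp add: norm_vec_def L2_set_def complex_norm_square[symmetric] sum_nonneg flip: of_real_power of_real_sum)
  have cross: "Re (\<Sum>i\<in>UNIV. v $ i * cnj (\<xi> $ i)) = - (c * norm x powr (p' - 2)) * I"
    by (simp add: I_def v_def a_def inner_sum_right inner_complex_def sum_distrib_left
        sum_negf algebra_simps sum.distrib)
  have C: "C_p p \<xi> \<eta> = norm \<xi> powr p - norm v powr p
      + p * norm v powr (p - 2) * (c * norm x powr (p' - 2) * I + (norm v)\<^sup>2)"
  proof -
    have "Re (\<Sum>i\<in>UNIV. v $ i * cnj (\<eta> $ i)) = - (c * norm x powr (p' - 2)) * I - (norm v)\<^sup>2"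
      unfolding sq[symmetric] cross[symmetric]
      by (simp add: \<eta>_def right_diff_distrib sum_subtractf)
    moreover have "\<xi> - \<eta> = v" by (simp add: \<eta>_def)
    ultimately show ?thesis unfolding C_p_def by (simp only:) (simp add: algebra_simps)
  qed
  show ?thesis
  proof (cases "c = 0 \<or> x = 0 \<or> w = 0")
    case True
    \<comment> \<open>The powers cannot be combined when a base is zero, as \<open>0 powr 0 = 0\<close>; but then both
      sides reduce to \<open>|\<xi>| powr p\<close>.\<close>
    then have "norm v = 0" using norm_v by auto
    moreover have "I = 0 \<or> c = 0" using True by (auto simp: I_def)
    ultimately show ?thesis
      using True unfolding \<eta>_eq C I_def[symmetric] by auto
  next
    case False
    then have pos: "0 < c" "0 < norm x" "0 < norm w" using c by auto
    have nv: "norm v = c * norm x powr (p' - 1) * norm w"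
      using norm_v pos powr_add[of "norm x" "p' - 2" 1] by simp
    have "0 < norm v" using nv pos by simp
    have e1: "(p' - 1) * p = p'" and e2: "(p' - 1) * (p - 2) + (p' - 2) = 0"
      using p by (auto simp: p' field_simps)
    have vp: "norm v powr p = c powr p * (norm x powr p' * norm w powr p)"
      using pos by (simp add: nv powr_mult powr_powr e1)
    have v2: "norm v powr (p - 2) * (norm v)\<^sup>2 = norm v powr p"
      using \<open>0 < norm v\<close> powr_add[of "norm v" "p - 2" 2] by (simp add: powr_numeral)
    have "norm v powr (p - 2) * (c * norm x powr (p' - 2))
        = (c powr (p - 2) * c) * (norm x powr ((p' - 1) * (p - 2)) * norm x powr (p' - 2)) * norm w powr (p - 2)"
      using pos by (simp add: nv powr_mult powr_powr)
    also have "\<dots> = c powr (p - 1) * norm w powr (p - 2)"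
      using pos powr_add[of c "p - 2" 1] by (simp add: powr_add[symmetric] e2)
    finally have v1: "norm v powr (p - 2) * (c * norm x powr (p' - 2)) = c powr (p - 1) * norm w powr (p - 2)" .
    have "C_p p \<xi> \<eta> = norm \<xi> powr p - norm v powr p
        + p * (norm v powr (p - 2) * (c * norm x powr (p' - 2))) * I
        + p * (norm v powr (p - 2) * (norm v)\<^sup>2)"
      unfolding C by (simp add: algebra_simps)
    then show ?thesis
      unfolding \<eta>_eq I_def[symmetric] v1 v2 vp by (simp add: algebra_simps)
  qed
qed

section \<open>Integrals\<close>

lemma integrable_continuous_compact_support:
  fixes h :: "'a::euclidean_space \<Rightarrow> real"
  assumes "continuous_on UNIV h" and "compact K" and "\<And>z. z \<notin> K \<Longrightarrow> h z = 0"
  shows "integrable lborel h"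
proof -
  have "integrable lborel (\<lambda>z. indicator K z *\<^sub>R h z)"
    by (rule borel_integrable_compact) (use assms in \<open>auto intro: continuous_on_subset\<close>)
  moreover have "(\<lambda>z. indicator K z *\<^sub>R h z) = h"
    using assms(3) by (auto simp: indicator_def fun_eq_iff)
  ultimately show ?thesis by simp
qed

text \<open>
  The origin is excepted so that \<open>h\<close> may contain a weight such as \<open>|z| powr p'\<close>. Were the
  integral zero, the nonempty open set where \<open>f\<close> does not vanish would be negligible.
\<close>

lemma integral_pos_of_continuous_support:
  fixes f :: "'a::euclidean_space \<Rightarrow> 'b::real_normed_vector"
  assumes f: "continuous_on UNIV f" "f \<noteq> (\<lambda>z. 0)"
    and h: "integrable lborel h" "\<And>z. (0::real) \<le> h z" "\<And>z. z \<noteq> 0 \<Longrightarrow> f z \<noteq> 0 \<Longrightarrow> h z \<noteq> 0"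
  shows "0 < (LBINT z. h z)"
proof (rule ccontr)
  assume "\<not> ?thesis"
  moreover have "0 \<le> (LBINT z. h z)" using h(2) by simp
  ultimately have "(LBINT z. h z) = 0" by simp
  then have "AE z in lborel. h z = 0"
    using integral_nonneg_eq_0_iff_AE[OF h(1)] h(2) by simp
  moreover have "AE z in lborel. z \<noteq> (0::'a)"
    by (rule AE_lborel_singleton)
  ultimately have "AE z in lborel. z \<notin> {z. f z \<noteq> 0}"
    by eventually_elim (use h(3) in auto)
  moreover have "open {z. f z \<noteq> 0}"
    by (rule open_Collect_neq) (use f in auto)
  ultimately have "negligible {z. f z \<noteq> 0}" "open {z. f z \<noteq> 0}"
    by (simp_all add: negligible_iff_null_sets null_sets_completionI AE_iff_null_sets AE_completion)
  then show False
    using open_not_negligible f(2) by blast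
qed

text \<open>
  Here \<open>g' z z\<close> is the Euler derivative \<open>z \<cdot> \<nabla>g(z)\<close>, the derivative of \<open>g((1 + t) z)\<close> in \<open>t\<close>
  at \<open>t = 0\<close>. The integral of \<open>g((1 + t) z)\<close> is \<open>(1 + t)\<close> to the power \<open>- n\<close> times that of
  \<open>g\<close>, where \<open>n\<close> is the dimension, and differentiating this
  at \<open>t = 0\<close> gives the claim. The bound on the derivative makes \<open>g\<close> Lipschitz, so that
  the difference quotients are dominated by a multiple of the indicator of a ball.
\<close>

lemma integral_euler_derivative:
  fixes g :: "'a::euclidean_space \<Rightarrow> real"
  assumes deriv: "\<And>z. (g has_derivative g' z) (at z)"
    and bound: "\<And>z v. \<bar>g' z v\<bar> \<le> L * norm v"
    and supp: "\<And>z. R < norm z \<Longrightarrow> g z = 0"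
    and "integrable lborel g"
  shows "has_bochner_integral lborel (\<lambda>z. g' z z) (- real DIM('a) * (LBINT z. g z))"
proof -
  \<comment> \<open>Only positive \<open>t\<close> are used: if \<open>z\<close> lies outside the ball, so does \<open>(1 + t) z\<close>.\<close>
  define t :: "nat \<Rightarrow> real" where "t k = 1 / real (k + 2)" for k
  have t: "0 < t k" "t k \<le> 1 / 2" for k
    by (auto simp: t_def field_simps)
  have t_lim: "t \<longlonglongrightarrow> 0"
    unfolding t_def by (rule LIMSEQ_ignore_initial_segment[OF lim_1_over_n])
  have t_at: "filterlim t (at 0) sequentially"
    using t_lim t by (auto simp: filterlim_at less_imp_neq[symmetric])
  define q where "q k z = (g ((1 + t k) *\<^sub>R z) - g z) / t k" for k z
  have contg: "continuous_on UNIV g"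
    by (meson deriv has_derivative_continuous continuous_at_imp_continuous_on)
  have [measurable]: "g \<in> borel_measurable borel"
    by (rule borel_measurable_continuous_onI[OF contg])
  have "0 \<le> L"
  proof -
    obtain b :: 'a where "norm b = 1" using vector_choose_size[of 1] by auto
    then show ?thesis using bound[of 0 b] by auto
  qed
  have lip: "\<bar>g y - g x\<bar> \<le> L * norm (y - x)" for x y
  proof -
    have on: "onorm (g' z) \<le> L" for z
      by (rule onorm_bound) (use bound \<open>0 \<le> L\<close> in auto)
    show ?thesis
      using differentiable_bound[of UNIV g g' L x y] deriv on by (auto simp: norm_minus_commute abs_minus_commute)
  qed
  have q_bound: "norm (q k z) \<le> L * R * indicator (cball 0 R) z" for k z
  proof (cases "norm z \<le> R")
    case True
    have "\<bar>g ((1 + t k) *\<^sub>R z) - g z\<bar> \<le> L * norm ((1 + t k) *\<^sub>R z - z)"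
      by (rule lip)
    also have "(1 + t k) *\<^sub>R z - z = t k *\<^sub>R z" by (simp add: algebra_simps)
    also have "L * norm (t k *\<^sub>R z) \<le> L * (t k * R)"
      using \<open>0 \<le> L\<close> t[of k] True by (intro mult_left_mono) auto
    finally show ?thesis
      using t[of k] True by (simp add: q_def field_simps)
  next
    case False
    have "norm z \<le> norm ((1 + t k) *\<^sub>R z)"
      using t[of k] by (simp add: mult_le_cancel_right1)
    then show ?thesis using False supp by (simp add: q_def)
  qed
  have q_lim: "(\<lambda>k. q k z) \<longlonglongrightarrow> g' z z" for z
  proof -
    have "((\<lambda>s. z + s *\<^sub>R z) has_derivative (\<lambda>s. s *\<^sub>R z)) (at (0::real))"
      by (auto intro!: derivative_eq_intros)
    from has_derivative_compose[OF this, of g "g' z"] deriv[of z]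
    have "((\<lambda>s. g (z + s *\<^sub>R z)) has_derivative (\<lambda>s. g' z (s *\<^sub>R z))) (at 0)"
      by simp
    moreover have "g' z (s *\<^sub>R z) = s * g' z z" for s
      using deriv[of z] linear_cmul[OF bounded_linear.linear[OF has_derivative_bounded_linear]]
      by fastforce
    ultimately have "((\<lambda>s. g (z + s *\<^sub>R z)) has_real_derivative g' z z) (at 0)"
      by (simp add: has_field_derivative_def mult_commute_abs)
    then have "((\<lambda>s. (g (z + s *\<^sub>R z) - g z) / s) \<longlongrightarrow> g' z z) (at 0)"
      by (simp add: has_field_derivative_iff)
    from filterlim_compose[OF this t_at] show ?thesis
      by (simp add: q_def algebra_simps)
  qed
  have q_meas [measurable]: "q k \<in> borel_measurable borel" for k
    unfolding q_def by measurable
  have D_meas [measurable]: "(\<lambda>z. g' z z) \<in> borel_measurable borel"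
    by (rule borel_measurable_LIMSEQ_real[OF q_lim q_meas])
  have dom: "integrable lborel (\<lambda>z::'a. L * R * indicator (cball 0 R) z)"
    by (intro integrable_mult_right integrable_real_indicator)
      (auto intro: emeasure_bounded_finite[unfolded infinity_ennreal_def])
  have int: "integrable lborel (\<lambda>z. g' z z)"
    by (rule integrable_dominated_convergence[OF _ _ dom, of _ q])
      (use q_lim q_bound in auto)
  have lim1: "(\<lambda>k. LBINT z. q k z) \<longlonglongrightarrow> (LBINT z. g' z z)"
    by (rule integral_dominated_convergence[OF _ _ dom])
      (use q_lim q_bound in auto)
  have scale: "has_bochner_integral lborel (\<lambda>z. g (s *\<^sub>R z)) ((LBINT z. g z) / s ^ DIM('a))"
    if "0 < s" for s
  proof -
    have lb: "lborel = density (distr lborel borel (\<lambda>z::'a. s *\<^sub>R z)) (\<lambda>_. ennreal (s ^ DIM('a)))"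
      using lborel_affine[of s 0] that by (simp add: ennreal_power)
    have "integrable (density (distr lborel borel (\<lambda>z::'a. s *\<^sub>R z)) (\<lambda>_. ennreal (s ^ DIM('a)))) g"
      using \<open>integrable lborel g\<close> by (simp add: lb[symmetric])
    then have "integrable lborel (\<lambda>z. g (s *\<^sub>R z))"
      using that by (simp add: integrable_density integrable_distr_eq)
    moreover have "(LBINT z. g z) = s ^ DIM('a) * (LBINT z. g (s *\<^sub>R z))"
      using that by (subst lb) (simp add: integral_density integral_distr)
    ultimately show ?thesis
      using that by (simp add: has_bochner_integral_iff)
  qed
  have q_int: "(LBINT z. q k z) = (inverse ((1 + t k) ^ DIM('a)) - 1) / t k * (LBINT z. g z)" for k
  proof -
    have "has_bochner_integral lborel (q k)
        (((LBINT z. g z) / (1 + t k) ^ DIM('a) - (LBINT z. g z)) / t k)"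
      unfolding q_def using t[of k] \<open>integrable lborel g\<close>
      by (intro has_bochner_integral_divide has_bochner_integral_diff scale
          has_bochner_integral_integrable) auto
    from has_bochner_integral_integral_eq[OF this] show ?thesis
      by (simp add: field_simps)
  qed
  have "((\<lambda>s. inverse ((1 + s) ^ DIM('a))) has_real_derivative - real DIM('a)) (at 0)"
    by (auto intro!: derivative_eq_intros)
  then have "((\<lambda>s::real. (inverse ((1 + s) ^ DIM('a)) - 1) / s) \<longlongrightarrow> - real DIM('a)) (at 0)"
    by (simp add: has_field_derivative_iff)
  from filterlim_compose[OF this t_at]
  have "(\<lambda>k. LBINT z. q k z) \<longlonglongrightarrow> - real DIM('a) * (LBINT z. g z)"
    unfolding q_int by (intro tendsto_mult tendsto_const)
  with lim1 have "(LBINT z. g' z z) = - real DIM('a) * (LBINT z. g z)"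
    by (rule LIMSEQ_unique)
  then show ?thesis
    using int by (simp add: has_bochner_integral_iff)
qed

section \<open>The identity\<close>

theorem corollary3p15:
  fixes p p' \<alpha> :: real and f :: "real^'n \<Rightarrow> complex"
  assumes "1 < p"
    and "p' = p / (p - 1)"
    and "f \<in> test_functions"
    and "f \<noteq> (\<lambda>z. 0)"
    and "\<alpha> = real CARD('n) / p * ((p - 1) / p) *
           ((LBINT z. norm (f z) powr p) / (LBINT z. norm z powr p' * norm (f z) powr p))"
  shows "(LBINT z. norm (grad f z) powr p)
           * (LBINT z. norm z powr p' * norm (f z) powr p) powr (p - 1)
         - (real CARD('n) / p) powr p * (LBINT z. norm (f z) powr p) powr p
       = (LBINT z. norm z powr p' * norm (f z) powr p) powr (p - 1)
           * (LBINT z. C_p p (grad f z)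
               (exp (- \<alpha> * norm z powr p') *\<^sub>R
                 grad (\<lambda>w. f w / complex_of_real (exp (- \<alpha> * norm w powr p'))) z))"
proof -
  note p = \<open>1 < p\<close>
  have p': "1 < p'" using assms(1,2) by simp
  define A where "A = (LBINT z. norm (grad f z) powr p)"
  define B where "B = (LBINT z. norm z powr p' * norm (f z) powr p)"
  define M where "M = (LBINT z. norm (f z) powr p)"
  define c where "c = \<alpha> * p'"
  define K where "K = closure {z. f z \<noteq> 0}"
  have "C_k (Suc 0) f" and K: "compact K"
    using assms(3) unfolding test_functions_def K_def by blast+
  from this(1) have "f differentiable_on UNIV" and contp: "continuous_on UNIV (partial i f)" for i
    by simp_all
  then obtain f' where f': "(f has_derivative f' z) (at z)" for z
    unfolding differentiable_on_def differentiable_def by (metis UNIV_I)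
  have contf: "continuous_on UNIV f"
    by (meson f' has_derivative_continuous continuous_at_imp_continuous_on)
  have f0: "f z = 0" if "z \<notin> K" for z
    using that closure_subset[of "{z. f z \<noteq> 0}"] by (auto simp: K_def)
  have partial0: "partial i f z = 0" if "z \<notin> K" for z i
  proof -
    have "open (- K)" "z \<in> - K" using K that by (auto simp: compact_imp_closed)
    then have "(f has_derivative (\<lambda>_. 0)) (at z)"
      by (intro has_derivative_transform_within_open[OF has_derivative_const[of 0]]) (auto simp: f0)
    from partial_eq_derivative[OF this] show ?thesis .
  qed
  then have grad0: "grad f z = 0" if "z \<notin> K" for z
    using that by (simp add: grad_def vec_eq_iff)
  have contg: "continuous_on UNIV (grad f)"
    unfolding grad_def[abs_def] by (intro continuous_on_vec_lambda contp)

  note cont_intros = continuous_on_norm_powr continuous_on_mult continuous_on_id continuous_on_const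
    continuous_on_sum continuous_on_norm
  have intA: "integrable lborel (\<lambda>z. norm (grad f z) powr p)"
    by (rule integrable_continuous_compact_support[OF _ K])
      (use p contg grad0 in \<open>auto intro!: cont_intros\<close>)
  have intB: "integrable lborel (\<lambda>z. norm z powr p' * norm (f z) powr p)"
    by (rule integrable_continuous_compact_support[OF _ K])
      (use p p' contf f0 in \<open>auto intro!: cont_intros\<close>)
  have intM: "integrable lborel (\<lambda>z. norm (f z) powr p)"
    by (rule integrable_continuous_compact_support[OF _ K])
      (use p contf f0 in \<open>auto intro!: cont_intros\<close>)
  have B: "0 < B"
    unfolding B_def by (rule integral_pos_of_continuous_support[OF contf assms(4) intB]) auto
  have M: "0 < M"
    unfolding M_def by (rule integral_pos_of_continuous_support[OF contf assms(4) intM]) auto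
  have c: "c = real CARD('n) / p * (M / B)"
    using p by (simp add: c_def assms(5) assms(2) A_def B_def M_def)
  have "0 < c" using c p B M by simp

  define D where "D z v = p * norm (f z) powr (p - 2) * (f z \<bullet> f' z v)" for z v
  have D: "((\<lambda>z. norm (f z) powr p) has_derivative D z) (at z)" for z
    unfolding D_def using has_derivative_compose[OF f' has_derivative_norm_powr[OF p]] .
  \<comment> \<open>The norm of \<open>D z\<close> is at most \<open>p |f| powr (p - 1)\<close> times the sum of the norms of the
    partial derivatives, a continuous function that vanishes off \<open>K\<close>.\<close>
  have "\<exists>L. \<forall>z v. \<bar>D z v\<bar> \<le> L * norm v"
  proof -
    define h where "h z = p * norm (f z) powr (p - 1) * (\<Sum>i\<in>UNIV. norm (partial i f z))" for z
    have "continuous_on UNIV h"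
      unfolding h_def by (use p contf contp in \<open>auto intro!: cont_intros\<close>)
    then have "bounded (h ` K)"
      using K by (meson compact_continuous_image compact_imp_bounded continuous_on_subset subset_UNIV)
    then obtain L where L: "\<And>z. z \<in> K \<Longrightarrow> norm (h z) \<le> L" and "0 < L"
      unfolding bounded_pos by auto
    have "h z \<le> L" for z
      using L[of z] \<open>0 < L\<close> f0[of z] by (cases "z \<in> K") (auto simp: h_def)
    moreover have "\<bar>D z v\<bar> \<le> h z * norm v" for z v
    proof -
      have "norm (f' z v) \<le> (\<Sum>i\<in>UNIV. norm (partial i f z)) * norm v"
        unfolding derivative_eq_sum_partial[OF f', of z v] sum_distrib_right
        by (rule order_trans[OF norm_sum])
          (auto intro!: sum_mono mult_right_mono component_le_norm_cart 
            simp: norm_mult mult.commute[of "norm (partial _ _ _)"])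
      then have "\<bar>f z \<bullet> f' z v\<bar> \<le> norm (f z) * ((\<Sum>i\<in>UNIV. norm (partial i f z)) * norm v)"
        by (meson Cauchy_Schwarz_ineq2 order_trans mult_left_mono norm_ge_zero)
      then have "\<bar>D z v\<bar> \<le> p * norm (f z) powr (p - 2) * (norm (f z) * ((\<Sum>i\<in>UNIV. norm (partial i f z)) * norm v))"
        unfolding D_def abs_mult using p by (intro mult_mono) auto
      also have "\<dots> = p * (norm (f z) powr (p - 2) * norm (f z)) * (\<Sum>i\<in>UNIV. norm (partial i f z)) * norm v"
        by simp
      also have "norm (f z) powr (p - 2) * norm (f z) = norm (f z) powr (p - 1)"
        using powr_add[of "norm (f z)" "p - 2" 1] by (cases "f z = 0") simp_all
      finally show ?thesis by (simp add: h_def)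
    qed
    ultimately show ?thesis by (meson mult_right_mono norm_ge_zero order_trans)
  qed
  then obtain L where L: "\<And>z v. \<bar>D z v\<bar> \<le> L * norm v" by blast
  obtain R where R: "\<And>z. z \<in> K \<Longrightarrow> norm z \<le> R"
    using compact_imp_bounded[OF K] unfolding bounded_iff by blast
  have intD: "has_bochner_integral lborel (\<lambda>z. D z z) (- real CARD('n) * M)"
    using integral_euler_derivative[OF D L _ intM, of R] R f0 unfolding M_def by force

  have C: "C_p p (grad f z)
        (exp (- \<alpha> * norm z powr p') *\<^sub>R
          grad (\<lambda>w. f w / complex_of_real (exp (- \<alpha> * norm w powr p'))) z)
      = norm (grad f z) powr p + (p - 1) * c powr p * (norm z powr p' * norm (f z) powr p)
        + c powr (p - 1) * D z z" for z
    unfolding grad_radial_quotient[OF p' f'] c_def[symmetric]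
    using C_p_shift_radial[OF p assms(2) less_imp_le[OF \<open>0 < c\<close>], of "grad f z" z "f z"]
    by (simp add: D_def derivative_eq_sum_partial[OF f', of z z] grad_def)
  have integral_C: "(LBINT z. C_p p (grad f z)
        (exp (- \<alpha> * norm z powr p') *\<^sub>R
          grad (\<lambda>w. f w / complex_of_real (exp (- \<alpha> * norm w powr p'))) z))
      = A + ((p - 1) * c powr p * B + c powr (p - 1) * (- real CARD('n) * M))"
    unfolding C A_def B_def add.assoc[symmetric]
    by (intro has_bochner_integral_integral_eq has_bochner_integral_add
        has_bochner_integral_mult_right has_bochner_integral_integrable intA intB intD)
  have remainder: "B powr (p - 1) * ((p - 1) * c powr p * B + c powr (p - 1) * (- real CARD('n) * M))
      = - ((real CARD('n) / p) powr p * M powr p)"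
  proof -
    \<comment> \<open>The value of \<open>\<alpha>\<close> makes the last term \<open>- p\<close> times \<open>(c B) powr p\<close>.\<close>
    have cB: "real CARD('n) * M = p * (c * B)" using c p B by simp
    have "c powr p = c powr (p - 1) * c" and "B powr p = B powr (p - 1) * B"
      using powr_add[of c "p - 1" 1] powr_add[of B "p - 1" 1] \<open>0 < c\<close> B by simp_all
    then have "B powr (p - 1) * ((p - 1) * c powr p * B + c powr (p - 1) * (- real CARD('n) * M))
        = - (c powr p * B powr p)"
      using cB by (simp add: algebra_simps)
    also have "c powr p * B powr p = (c * B) powr p"
      using B \<open>0 < c\<close> by (simp add: powr_mult)
    also have "c * B = real CARD('n) / p * M"
      using c B by simp
    also have "\<dots> powr p = (real CARD('n) / p) powr p * M powr p"
      by (rule powr_mult)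
    finally show ?thesis .
  qed
  show ?thesis
    unfolding A_def[symmetric] B_def[symmetric] M_def[symmetric] integral_C distrib_left[of _ A] remainder
    by simp
qed

end
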